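(* Let $\lambda$ be a partition and $\pi$ a reverse plane partition of shape $\lambda$. Then there exists a sequence of rim-hooks $h_1,\dots,h_s$ of $\lambda$ such that $h_i$ inserts into $h_{i-1}*\cdots*h_1*0$ for all $i\in\{1,\dots,s\}$ and $\pi=h_s*\cdots*h_1*0$, where $0$ is the zero reverse plane partition of shape $\lambda$.
   Context: Cells are pairs $(i,j)\in\mathbb Z^2$; $\mathrm n(i,j)=(i-1,j)$, $\mathrm e(i,j)=(i,j+1)$, $\mathrm s(i,j)=(i+1,j)$, $\mathrm w(i,j)=(i,j-1)$. A partition $\lambda$ is identified with its Young diagram. A reverse plane partition of shape $\lambda$ is $\pi:\lambda\to\mathbb N$ with $\pi(u)\le\pi(\mathrm e u),\pi(\mathrm s u)$, with conventions $\pi(i,j)=0$ if $i\le0$ or $j\le0$, $\pi(i,j)=\infty$ if $i,j\ge1$, $(i,j)\notin\lambda$. Content $c(i,j)=j-i$; outer corner: $u\in\lambda$, $\mathrm e u,\mathrm s u\notin\lambda$; inner corner: $\mathrm e u,\mathrm s u\in\lambda$, $\mathrm e\mathrm s u\notin\lambda$. With inner corner contents $i_1<\dots<i_r$ and outer corner contents $o_1<\dots<o_{r+1}$ (interlacing), $\mathcal I=\{u\in\lambda:c(u)=i_k\}$, $\mathcal O=\{u\in\lambda:c(u)=o_k\}$, $\mathcal A=\{u\in\lambda:c(u)<o_1\text{ or }i_k<c(u)<o_{k+1}\text{ for some }k\in[r]\}$, $\mathcal B=\{u\in\lambda:o_k<c(u)<i_k\text{ for some }k\in[r]\text{ or }c(u)>o_{r+1}\}$.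 North-east path: $(u_0,\dots,u_s)$ in $\lambda$, $u_k\in\{\mathrm n u_{k-1},\mathrm e u_{k-1}\}$, length $s$, head $\alpha=u_0$, tail $\omega=u_s$. South-west path: $(v_0,\dots,v_s)$, $v_k\in\{\mathrm s v_{k-1},\mathrm w v_{k-1}\}$, length $s$, $\alpha=v_s$, $\omega=v_0$. Rim-hook: north-east path $h$ with $\mathrm s\alpha(h)\notin\lambda$, $\mathrm e\omega(h)\notin\lambda$, $\mathrm e\mathrm s u\notin\lambda$ for all $u\in h$. $(\pi+P)(u)=\pi(u)+1$ for $u\in P$, else $\pi(u)$. $(P,\pi)$ compatible: $u\in P\cap(\mathcal I\cup\mathcal A)$ implies $\mathrm e u\in P$ and $\pi(u)=\pi(\mathrm e u)$; $u,\mathrm s u\in P$ implies $\pi(u)=\pi(\mathrm s u)$. $h$ inserts into $\pi$ if some path $P$ has $\omega(P)=\omega(h)$, $\ell(P)=\ell(h)$, $(P,\pi)$ compatible and $\pi+P$ a reverse plane partition; then $h*\pi=\pi+P(h,\pi)$, with $P(h,\pi)$ the south-west path starting at $\omega(h)$ which, while its length is less than $\ell(h)$, moves from current cell $u$ to $\mathrm s u$ if $u\in\mathcal B\cup\mathcal I$ and $\pi(u)=\pi(\mathrm s u)$, and to $\mathrm w u$ otherwise. Iterated insertion is read right to left: $h_s*\cdots*h_1*0=h_s*(\cdots(h_1*0))$. *)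

theory Defs
  imports Main "HOL-Library.Extended_Nat"
begin

text \<open>Rows and columns are numbered from 1; the row index increases southwards.\<close>

type_synonym cell = "int \<times> int"

fun north :: "cell \<Rightarrow> cell" where "north (i, j) = (i - 1, j)"
fun east :: "cell \<Rightarrow> cell" where "east (i, j) = (i, j + 1)"
fun south :: "cell \<Rightarrow> cell" where "south (i, j) = (i + 1, j)"
fun west :: "cell \<Rightarrow> cell" where "west (i, j) = (i, j - 1)"

fun content :: "cell \<Rightarrow> int" where "content (i, j) = j - i"

definition is_partition :: "nat list \<Rightarrow> bool" where
  "is_partition p \<longleftrightarrow> sorted_wrt (\<ge>) p \<and> 0 \<notin> set p"

definition young_diagram :: "nat list \<Rightarrow> cell set" where
  "young_diagram p =
     {(i, j). 1 \<le> i \<and> i \<le> int (length p) \<and> 1 \<le> j \<and> j \<le> int (p ! nat (i - 1))}"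

text \<open>
  From here on \<open>L\<close> is the Young diagram of the shape. A filling is a function on all cells with
  values in \<^typ>\<open>enat\<close>, so that the conventions for its values outside \<open>L\<close> (0 to the north and
  west, infinity to the south and east) are part of the object, and two reverse plane partitions
  of the same shape are equal as functions iff they agree on \<open>L\<close>.
\<close>

type_synonym filling = "cell \<Rightarrow> enat"

definition rpp :: "cell set \<Rightarrow> filling \<Rightarrow> bool" where
  "rpp L \<pi> \<longleftrightarrow>
     (\<forall>u\<in>L. \<pi> u \<noteq> \<infinity>) \<and>
     (\<forall>i j. i \<le> 0 \<or> j \<le> 0 \<longrightarrow> \<pi> (i, j) = 0) \<and>
     (\<forall>i j. 1 \<le> i \<and> 1 \<le> j \<and> (i, j) \<notin> L \<longrightarrow> \<pi> (i, j) = \<infinity>) \<and>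
     (\<forall>u\<in>L. \<pi> u \<le> \<pi> (east u) \<and> \<pi> u \<le> \<pi> (south u))"

definition zero_rpp :: "cell set \<Rightarrow> filling" where
  "zero_rpp L = (\<lambda>(i, j). if (i, j) \<in> L \<or> i \<le> 0 \<or> j \<le> 0 then 0 else \<infinity>)"

definition outer_corners :: "cell set \<Rightarrow> cell set" where
  "outer_corners L = {u \<in> L. east u \<notin> L \<and> south u \<notin> L}"

definition inner_corners :: "cell set \<Rightarrow> cell set" where
  "inner_corners L = {u. east u \<in> L \<and> south u \<in> L \<and> east (south u) \<notin> L}"

text \<open>
  The lists below are 0-based: \<open>o\<^sub>k\<close> is \<open>outer_contents L ! (k - 1)\<close> and \<open>i\<^sub>k\<close> is
  \<open>inner_contents L ! (k - 1)\<close>. For nonempty \<open>L\<close> there is one more outer corner than there are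
  inner corners, so every list access in the regions below is in range; for empty \<open>L\<close> the regions
  are empty.
\<close>

definition outer_contents :: "cell set \<Rightarrow> int list" where
  "outer_contents L = sorted_list_of_set (content ` outer_corners L)"

definition inner_contents :: "cell set \<Rightarrow> int list" where
  "inner_contents L = sorted_list_of_set (content ` inner_corners L)"

definition region_I :: "cell set \<Rightarrow> cell set" where
  "region_I L = {u \<in> L. content u \<in> set (inner_contents L)}"

definition region_A :: "cell set \<Rightarrow> cell set" where
  "region_A L = {u \<in> L. content u < outer_contents L ! 0 \<or>
     (\<exists>k < length (inner_contents L).
        inner_contents L ! k < content u \<and> content u < outer_contents L ! Suc k)}"

definition region_B :: "cell set \<Rightarrow> cell set" where
  "region_B L = {u \<in> L.
     (\<exists>k < length (inner_contents L).
        outer_contents L ! k < content u \<and> content u < inner_contents L ! k) \<or>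
     outer_contents L ! length (inner_contents L) < content u}"

text \<open>
  The head of a north-east path is its first cell and its tail the last one; for a south-west path
  it is the other way round.
\<close>

definition ne_path :: "cell set \<Rightarrow> cell list \<Rightarrow> bool" where
  "ne_path L P \<longleftrightarrow> P \<noteq> [] \<and> set P \<subseteq> L \<and>
     (\<forall>k. Suc k < length P \<longrightarrow> P ! Suc k \<in> {north (P ! k), east (P ! k)})"

definition sw_path :: "cell set \<Rightarrow> cell list \<Rightarrow> bool" where
  "sw_path L P \<longleftrightarrow> P \<noteq> [] \<and> set P \<subseteq> L \<and>
     (\<forall>k. Suc k < length P \<longrightarrow> P ! Suc k \<in> {south (P ! k), west (P ! k)})"

definition path_length :: "cell list \<Rightarrow> nat" where
  "path_length P = length P - 1"

definition rim_hook :: "cell set \<Rightarrow> cell list \<Rightarrow> bool" where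
  "rim_hook L h \<longleftrightarrow> ne_path L h \<and> south (hd h) \<notin> L \<and> east (last h) \<notin> L \<and>
     (\<forall>u\<in>set h. east (south u) \<notin> L)"

definition add_path :: "filling \<Rightarrow> cell list \<Rightarrow> filling" where
  "add_path \<pi> P = (\<lambda>u. if u \<in> set P then \<pi> u + 1 else \<pi> u)"

definition compatible :: "cell set \<Rightarrow> cell list \<Rightarrow> filling \<Rightarrow> bool" where
  "compatible L P \<pi> \<longleftrightarrow>
     (\<forall>u \<in> set P \<inter> (region_I L \<union> region_A L). east u \<in> set P \<and> \<pi> u = \<pi> (east u)) \<and>
     (\<forall>u. u \<in> set P \<and> south u \<in> set P \<longrightarrow> \<pi> u = \<pi> (south u))"

definition inserts :: "cell set \<Rightarrow> cell list \<Rightarrow> filling \<Rightarrow> bool" where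
  "inserts L h \<pi> \<longleftrightarrow> (\<exists>P.
     (ne_path L P \<and> last P = last h \<or> sw_path L P \<and> hd P = last h) \<and>
     path_length P = path_length h \<and> compatible L P \<pi> \<and> rpp L (add_path \<pi> P))"

definition insertion_step :: "cell set \<Rightarrow> filling \<Rightarrow> cell \<Rightarrow> cell" where
  "insertion_step L \<pi> u =
     (if u \<in> region_B L \<union> region_I L \<and> \<pi> u = \<pi> (south u) then south u else west u)"

text \<open>The path with \<open>n\<close> steps starting at \<open>u\<close>.\<close>

fun insertion_path_from :: "cell set \<Rightarrow> filling \<Rightarrow> cell \<Rightarrow> nat \<Rightarrow> cell list" where
  "insertion_path_from L \<pi> u 0 = [u]"
| "insertion_path_from L \<pi> u (Suc n) = u # insertion_path_from L \<pi> (insertion_step L \<pi> u) n"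

definition insertion_path :: "cell set \<Rightarrow> cell list \<Rightarrow> filling \<Rightarrow> cell list" where
  "insertion_path L h \<pi> = insertion_path_from L \<pi> (last h) (path_length h)"

text \<open>The product \<open>h * \<pi>\<close>; only meaningful if \<open>h\<close> inserts into \<open>\<pi>\<close>.\<close>

definition insert_hook :: "cell set \<Rightarrow> cell list \<Rightarrow> filling \<Rightarrow> filling" where
  "insert_hook L h \<pi> = add_path \<pi> (insertion_path L h \<pi>)"

text \<open>For \<open>hs = [h\<^sub>1, \<dots>, h\<^sub>s]\<close> this is \<open>h\<^sub>s * (\<dots> * (h\<^sub>1 * 0))\<close>.\<close>

definition insert_hooks :: "cell set \<Rightarrow> cell list list \<Rightarrow> filling" where
  "insert_hooks L hs = fold (insert_hook L) hs (zero_rpp L)"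

end

theory Submission
  imports Defs
begin

text \<open>
  It suffices to remove one hook from a nonzero reverse plane partition \<open>\<pi>\<close>. Among the cells \<open>u\<close>
  in \<open>\<A> \<union> \<O>\<close> with \<open>\<pi> (w u) < \<pi> u\<close> choose one of maximal content and walk north-east from it:
  in \<open>\<A> \<union> \<I>\<close> step east; in \<open>\<B> \<union> \<O>\<close> step north if this does not change the value of \<open>\<pi>\<close>, and
  east otherwise, until a row end is reached. The invariant \<open>\<pi> (w n u) < \<pi> u\<close> and the maximality of
  the starting content show that lowering \<open>\<pi>\<close> by one along the walk gives a reverse plane partition,
  and that the insertion path into it is the reversed walk.
\<close>

section \<open>Moves between cells and their effect on contents\<close>

lemma content_simps [simp]:
  "content (north u) = content u + 1" "content (east u) = content u + 1"
  "content (south u) = content u - 1" "content (west u) = content u - 1"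
  by (cases u; simp)+

lemma cell_moves [simp]:
  "south (north u) = u" "north (south u) = u" "east (west u) = u" "west (east u) = u"
  "south (east u) = east (south u)" "north (east u) = east (north u)"
  "north (west u) = west (north u)" "south (west u) = west (south u)"
  "north u \<noteq> east u" "south u \<noteq> west u" "east u \<noteq> north u"
  by (cases u; simp)+

section \<open>Ranks in finite ordered sets\<close>

text \<open>Positions up to \<open>k\<close> inject into the elements below \<open>c\<close>, or
  else all those elements sit at positions before \<open>k\<close>. This turns comparisons with the
  \<open>k\<close>-th corner content into counts of corners, for which interlacing can be shown by
  induction.\<close>

lemma sorted_list_of_set_nth_le_iff:
  fixes S :: "'a :: linorder set"
  assumes "finite S" "k < length (sorted_list_of_set S)"
  shows "sorted_list_of_set S ! k \<le> c \<longleftrightarrow> k < card {x \<in> S. x \<le> c}"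
proof -
  define xs where "xs = sorted_list_of_set S"
  have xs: "sorted xs" "distinct xs" "set xs = S" "k < length xs"
    using assms by (auto simp: xs_def)
  have "k < card {x \<in> S. x \<le> c}" if "xs ! k \<le> c"
  proof -
    have "(!) xs ` {..k} \<subseteq> {x \<in> S. x \<le> c}"
      using that xs by (auto intro: order_trans[OF sorted_nth_mono])
    then have "card ((!) xs ` {..k}) \<le> card {x \<in> S. x \<le> c}"
      using assms by (intro card_mono) auto
    moreover have "card ((!) xs ` {..k}) = Suc k"
      using xs by (subst card_image) (auto simp: inj_on_def nth_eq_iff_index_eq)
    ultimately show ?thesis by simp
  qed
  moreover have "card {x \<in> S. x \<le> c} \<le> k" if "c < xs ! k"
  proof -
    have "{x \<in> S. x \<le> c} \<subseteq> (!) xs ` {..<k}"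
    proof
      fix x assume x: "x \<in> {x \<in> S. x \<le> c}"
      then obtain m where m: "m < length xs" "x = xs ! m"
        using xs by (metis (no_types, lifting) in_set_conv_nth mem_Collect_eq)
      have "m < k"
      proof (rule ccontr)
        assume "\<not> m < k"
        then have "xs ! k \<le> xs ! m" using m xs by (intro sorted_nth_mono) auto
        then show False using x m that by auto
      qed
      then show "x \<in> (!) xs ` {..<k}" using m by auto
    qed
    then have "card {x \<in> S. x \<le> c} \<le> card ((!) xs ` {..<k})"
      by (intro card_mono) auto
    also have "\<dots> \<le> k" using card_image_le[of "{..<k}" "(!) xs"] by simp
    finally show ?thesis .
  qed
  ultimately show ?thesis unfolding xs_def[symmetric] by force
qed

lemma card_le_add_one:
  fixes S :: "int set"
  assumes "finite S"
  shows "card {x \<in> S. x \<le> c + 1} = card {x \<in> S. x \<le> c} + of_bool (c + 1 \<in> S)"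
proof (cases "c + 1 \<in> S")
  case True
  then have "{x \<in> S. x \<le> c + 1} = insert (c + 1) {x \<in> S. x \<le> c}" by auto
  then show ?thesis using True assms by simp
next
  case False
  then have "x \<le> c + 1 \<longleftrightarrow> x \<le> c" if "x \<in> S" for x using that by (cases "x = c + 1") auto
  then have "{x \<in> S. x \<le> c + 1} = {x \<in> S. x \<le> c}" by blast
  then show ?thesis using False by simp
qed

section \<open>Row ends and corners of a diagram\<close>

locale diagram =
  fixes L :: "cell set"
  assumes fin: "finite L"
    and pos: "(i, j) \<in> L \<Longrightarrow> 1 \<le> i \<and> 1 \<le> j"
    and down: "(i, j) \<in> L \<Longrightarrow> 1 \<le> a \<Longrightarrow> a \<le> i \<Longrightarrow> 1 \<le> b \<Longrightarrow> b \<le> j \<Longrightarrow> (a, b) \<in> L"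
begin

text \<open>On \<open>L\<close>, \<open>row_end (content u)\<close> means \<open>u \<in> \<B> \<union> \<O>\<close>, and \<open>row_end (content u - 1)\<close> means
  \<open>u \<in> \<B> \<union> \<I>\<close>.\<close>

definition row_end :: "int \<Rightarrow> bool" where
  "row_end c \<longleftrightarrow> (\<exists>u\<in>L. east u \<notin> L \<and> content u = c)"

lemma east_mem_if_not_row_end: "u \<in> L \<Longrightarrow> \<not> row_end (content u) \<Longrightarrow> east u \<in> L"
  by (auto simp: row_end_def)

text \<open>The east edge of a row end of content \<open>c - 1\<close> and the south edge of a
  column bottom of content \<open>c\<close> would have to be the same step of the boundary path. In
  coordinates, one of \<open>v\<close>, \<open>u\<close> forces the missing neighbour of the other
  into \<open>L\<close>.\<close>

lemma not_row_end_if_south_notin: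
  assumes "u \<in> L" "south u \<notin> L"
  shows "\<not> row_end (content u - 1)"
proof
  assume "row_end (content u - 1)"
  then obtain v where v: "v \<in> L" "east v \<notin> L" "content v = content u - 1"
    by (auto simp: row_end_def)
  obtain i j a b where eq: "u = (i, j)" "v = (a, b)" by (cases u, cases v)
  have *: "b - a = j - i - 1" using v eq by simp
  show False
  proof (cases "a \<le> i")
    case True
    then have "(a, b + 1) \<in> L"
      using assms v eq * pos[of a b] down[of i j a "b + 1"] by auto
    then show False using v eq by simp
  next
    case False
    then have "(i + 1, j) \<in> L"
      using assms v eq * pos[of i j] down[of a b "i + 1" j] by auto
    then show False using assms eq by simp
  qed
qed

text \<open>Of two cells on a diagonal, the lower one forces the south-east neighbour of the upper
  one into \<open>L\<close>.\<close>

lemma rim_unique: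
  assumes "u \<in> L" "east (south u) \<notin> L" "v \<in> L" "east (south v) \<notin> L" "content u = content v"
  shows "u = v"
proof -
  obtain i j a b where eq: "u = (i, j)" "v = (a, b)" by (cases u, cases v)
  have *: "b - a = j - i" using assms eq by simp
  have "\<not> a < i" using assms eq * down[of i j "a + 1" "b + 1"] pos[of a b] by auto
  moreover have "\<not> i < a" using assms eq * down[of a b "i + 1" "j + 1"] pos[of i j] by auto
  ultimately show ?thesis using eq * by simp
qed

lemma east_south_notin:
  assumes "u \<in> L" "east u \<notin> L"
  shows "east (south u) \<notin> L"
proof -
  obtain i j where u: "u = (i, j)" by (cases u)
  have "(i, j + 1) \<in> L" if "(i + 1, j + 1) \<in> L"
    using that pos[of i j] assms(1) u down[OF that, of i "j + 1"] by auto
  then show ?thesis using assms u by auto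
qed

lemma outer_content_iff: "c \<in> content ` outer_corners L \<longleftrightarrow> row_end c \<and> \<not> row_end (c - 1)"
proof
  assume "c \<in> content ` outer_corners L"
  then obtain u where "u \<in> L" "east u \<notin> L" "south u \<notin> L" "c = content u"
    by (auto simp: outer_corners_def)
  then show "row_end c \<and> \<not> row_end (c - 1)"
    using not_row_end_if_south_notin by (auto simp: row_end_def)
next
  assume *: "row_end c \<and> \<not> row_end (c - 1)"
  then obtain u where u: "u \<in> L" "east u \<notin> L" "content u = c" by (auto simp: row_end_def)
  \<comment> \<open>Otherwise \<open>south u\<close> would end its row, with content
    \<open>c - 1\<close>.\<close>
  then have "south u \<notin> L" using * east_south_notin[of u] by (auto simp: row_end_def)
  then show "c \<in> content ` outer_corners L" using u by (auto simp: outer_corners_def)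
qed

lemma inner_corner_mem:
  assumes "u \<in> inner_corners L"
  shows "u \<in> L"
proof -
  obtain i j where u: "u = (i, j)" by (cases u)
  have "(i, j + 1) \<in> L" "(i + 1, j) \<in> L" using assms u by (auto simp: inner_corners_def)
  then show ?thesis using pos[of i "j + 1"] pos[of "i + 1" j] down[of i "j + 1" i j] u by auto
qed

lemma inner_content_row_end:
  assumes "c \<in> content ` inner_corners L"
  shows "row_end (c - 1)" "\<not> row_end c"
proof -
  obtain u where u: "u \<in> inner_corners L" "c = content u" using assms by auto
  then have u': "u \<in> L" "east u \<in> L" "south u \<in> L" "east (south u) \<notin> L"
    using inner_corner_mem[OF u(1)] by (auto simp: inner_corners_def)
  show "row_end (c - 1)"
    unfolding row_end_def by (rule bexI[of _ "south u"]) (use u(2) u' in simp_all)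
  show "\<not> row_end c"
  proof
    assume "row_end c"
    then obtain v where v: "v \<in> L" "east v \<notin> L" "content v = c" by (auto simp: row_end_def)
    \<comment> \<open>A row end is a rim cell, and so is the inner corner \<open>u\<close>.\<close>
    then have "u = v" using u u' east_south_notin[of v] by (intro rim_unique) auto
    then show False using u' v by simp
  qed
qed

text \<open>The cell above the row end of content \<open>c - 1\<close> is the inner corner. The cell
  \<open>v\<close> keeps that row end out of the first row, where the boundary path ends and no
  inner corner follows.\<close>

lemma inner_contentI:
  assumes "row_end (c - 1)" "\<not> row_end c" "v \<in> L" "c \<le> content v"
  shows "c \<in> content ` inner_corners L"
proof -
  obtain u where u: "u \<in> L" "east u \<notin> L" "content u = c - 1"
    using assms by (auto simp: row_end_def)
  obtain i j a b where eq: "u = (i, j)" "v = (a, b)" by (cases u, cases v)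
  have "i \<noteq> 1"
  proof
    assume "i = 1"
    then have "(i, j + 1) \<in> L"
      using assms u eq pos[of i j] pos[of a b] down[of a b i "j + 1"] by auto
    then show False using u eq by simp
  qed
  then have "north u \<in> L" using u eq pos[of i j] down[of i j "i - 1" j] by auto
  moreover from this have "east (north u) \<in> L"
    using assms u by (intro east_mem_if_not_row_end) auto
  ultimately have "north u \<in> inner_corners L" using u by (simp add: inner_corners_def)
  then show ?thesis using u by force
qed

section \<open>Interlacing of corner contents and the four regions\<close>

lemma finite_corner_contents:
  "finite (content ` outer_corners L)" "finite (content ` inner_corners L)"
proof -
  have "outer_corners L \<subseteq> L" "inner_corners L \<subseteq> L"
    using inner_corner_mem by (auto simp: outer_corners_def)
  then show "finite (content ` outer_corners L)" "finite (content ` inner_corners L)"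
    using fin finite_subset by blast+
qed

text \<open>Along the rim, \<open>row_end\<close> becomes true exactly at the outer corners and false exactly at the
  inner corners; this encodes the interlacing of the corner contents.\<close>

lemma card_outer_eq_card_inner:
  assumes "v \<in> L" "c \<le> content v"
  shows "card {x \<in> content ` outer_corners L. x \<le> c} =
    card {x \<in> content ` inner_corners L. x \<le> c} + of_bool (row_end c)"
proof -
  \<comment> \<open>A start below all contents, where both counts are zero; the minimum with
    \<open>c\<close> lets an upward induction reach \<open>c\<close>.\<close>
  define b where "b = min c (Min (content ` L) - 1)"
  have b: "b < content u" if "u \<in> L" for u
  proof -
    have "Min (content ` L) \<le> content u" using that fin by auto
    then show ?thesis by (simp add: b_def)
  qed
  have "b \<le> c" by (simp add: b_def)
  then show ?thesis using assms(2)
  proof (induction c rule: int_ge_induct)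
    case base
    have *: "{x \<in> content ` outer_corners L. x \<le> b} = {}"
      "{x \<in> content ` inner_corners L. x \<le> b} = {}"
      using inner_corner_mem by (auto simp: outer_corners_def not_le dest!: b)
    have "\<not> row_end b" by (auto simp: row_end_def dest: b)
    then show ?case unfolding * by simp
  next
    case (step c)
    have "c + 1 \<in> content ` outer_corners L \<longleftrightarrow> row_end (c + 1) \<and> \<not> row_end c"
      using outer_content_iff[of "c + 1"] by simp
    moreover have "c + 1 \<in> content ` inner_corners L \<longleftrightarrow> row_end c \<and> \<not> row_end (c + 1)"
      using inner_content_row_end[of "c + 1"] inner_contentI[of "c + 1" v] step.prems assms(1) by auto
    ultimately show ?case
      using step by (auto simp: card_le_add_one finite_corner_contents)
  qed
qed

text \<open>In region \<A>, position \<open>k\<close> gives at least \<open>Suc k\<close> inner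
  contents up to \<open>?c\<close> and at most \<open>Suc k\<close> outer ones, so the counts leave
  no room for a row end. Compatibility of the removed path rests on this.\<close>

lemma not_row_end_if_region_I_A:
  assumes "u \<in> region_I L \<union> region_A L"
  shows "\<not> row_end (content u)"
proof -
  let ?O = "content ` outer_corners L" and ?I = "content ` inner_corners L"
  let ?c = "content u"
  have "u \<in> L" using assms by (auto simp: region_I_def region_A_def)
  note card = card_outer_eq_card_inner[OF this order_refl]
  \<comment> \<open>If \<open>k\<close> is out of range, the list access is unspecified, but then
    there are at most \<open>k\<close> outer contents altogether.\<close>
  have card_O_le: "card {x \<in> ?O. x \<le> ?c} \<le> k" if "?c < outer_contents L ! k" for k
  proof (cases "k < length (outer_contents L)")
    case True
    then show ?thesis
      using that sorted_list_of_set_nth_le_iff[OF finite_corner_contents(1), of k ?c]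
      by (simp add: outer_contents_def)
  next
    case False
    have "card {x \<in> ?O. x \<le> ?c} \<le> card ?O"
      by (intro card_mono) (auto simp: finite_corner_contents)
    then show ?thesis using False by (simp add: outer_contents_def)
  qed
  consider "u \<in> region_I L" | "?c < outer_contents L ! 0"
    | k where "k < length (inner_contents L)" "inner_contents L ! k < ?c"
        "?c < outer_contents L ! Suc k"
    using assms by (auto simp: region_A_def)
  then show ?thesis
  proof cases
    case 1
    then show ?thesis
      using inner_content_row_end(2) finite_corner_contents
      by (auto simp: region_I_def inner_contents_def)
  next
    case 2
    then show ?thesis using card_O_le[of 0] card by auto
  next
    case (3 k)
    then have "k < card {x \<in> ?I. x \<le> ?c}"
      using sorted_list_of_set_nth_le_iff[OF finite_corner_contents(2), of k ?c]
      by (simp add: inner_contents_def)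
    then show ?thesis using card_O_le[of "Suc k"] 3 card by auto
  qed
qed

text \<open>With \<open>k\<close> inner contents up to \<open>content u\<close> there are
  \<open>k\<close> or \<open>Suc k\<close> outer ones. In the first case the row-end status has just
  switched off, at an inner content; in the second, \<open>u\<close> lies past the outer content at
  position \<open>k\<close> and before the inner one at that position, if there is one.\<close>

lemma region_B_I_if_row_end:
  assumes "u \<in> L" "row_end (content u - 1)"
  shows "u \<in> region_B L \<union> region_I L"
proof (cases "row_end (content u)")
  case False
  then have "content u \<in> content ` inner_corners L" using assms by (intro inner_contentI) auto
  then show ?thesis
    using assms finite_corner_contents by (auto simp: region_I_def inner_contents_def)
next
  case True
  let ?O = "content ` outer_corners L" and ?I = "content ` inner_corners L"
  let ?c = "content u"
  define k where "k = card {x \<in> ?I. x \<le> ?c}"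
  have k: "card {x \<in> ?O. x \<le> ?c} = Suc k"
    using card_outer_eq_card_inner[OF assms(1) order_refl] True by (simp add: k_def)
  have "card {x \<in> ?O. x \<le> ?c} \<le> card ?O" "card {x \<in> ?I. x \<le> ?c} \<le> card ?I"
    by (intro card_mono; auto simp: finite_corner_contents)+
  then have len: "k < length (outer_contents L)" "k \<le> length (inner_contents L)"
    using k by (auto simp: outer_contents_def inner_contents_def k_def)
  have "outer_contents L ! k \<le> ?c"
    using sorted_list_of_set_nth_le_iff[OF finite_corner_contents(1), of k ?c] k len
    by (simp add: outer_contents_def)
  moreover have "outer_contents L ! k \<in> ?O"
    using nth_mem[OF len(1)] finite_corner_contents by (simp add: outer_contents_def)
  moreover have "?c \<notin> ?O" using outer_content_iff assms by simp
  ultimately have o: "outer_contents L ! k < ?c" by (metis order_le_less)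
  moreover have "?c < inner_contents L ! k" if "k < length (inner_contents L)"
    using sorted_list_of_set_nth_le_iff[OF finite_corner_contents(2), of k ?c] that
    by (simp add: inner_contents_def k_def not_le[symmetric] del: not_le)
  ultimately show ?thesis
    using assms len by (auto simp: region_B_def le_less)
qed

section \<open>Paths along the rim\<close>

text \<open>Insertion sees only the tail and the length of a hook, so the hook to be inserted is the
  rim path sharing these with the walk. It is traced back from \<open>v\<close>, going south where
  possible and west otherwise.\<close>

lemma rim_path:
  assumes "v \<in> L" "east (south v) \<notin> L" "a \<in> L" "content v = content a + int n"
  shows "\<exists>h. ne_path L h \<and> last h = v \<and> length h = Suc n \<and> content (hd h) = content a \<and>
    (\<forall>u\<in>set h. east (south u) \<notin> L)"
  using assms
proof (induction n arbitrary: v)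
  case 0
  then show ?case by (intro exI[of _ "[v]"]) (auto simp: ne_path_def)
next
  case (Suc n)
  obtain v' where v': "v' \<in> L" "east (south v') \<notin> L" "content v' = content v - 1"
    "v \<in> {north v', east v'}"
  proof (cases "south v \<in> L")
    case True
    moreover have "east (south (south v)) \<notin> L" using Suc.prems True east_south_notin by blast
    ultimately show ?thesis using that[of "south v"] by simp
  next
    case False
    obtain i j k l where eq: "v = (i, j)" "a = (k, l)" by (cases v, cases a)
    \<comment> \<open>A cell of the first column without a cell below has the least content in
      \<open>L\<close>, but \<open>a\<close> has a smaller one.\<close>
    have "j \<noteq> 1"
    proof
      assume "j = 1"
      then have "(i + 1, j) \<in> L"
        using Suc.prems eq pos[of k l] pos[of i j] down[of k l "i + 1" j] by auto
      then show False using False eq by simp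
    qed
    then have "west v \<in> L" using Suc.prems eq pos[of i j] down[of i j i "j - 1"] by auto
    then show ?thesis using that[of "west v"] False by simp
  qed
  then obtain h where h: "ne_path L h" "last h = v'" "length h = Suc n"
    "content (hd h) = content a" "\<forall>u\<in>set h. east (south u) \<notin> L"
    using Suc.IH[of v'] Suc.prems by auto
  have "h ! n = v'" using h by (metis diff_Suc_1 last_conv_nth list.size(3) nat.distinct(1))
  then have "ne_path L (h @ [v])"
    using h v' Suc.prems(1) by (auto simp: ne_path_def nth_append less_Suc_eq)
  moreover have "h \<noteq> []" using h by auto
  ultimately show ?case using h Suc.prems by (intro exI[of _ "h @ [v]"]) auto
qed

end

section \<open>Monotonicity of reverse plane partitions across the border\<close>

lemma rpp_finite: "rpp L \<pi> \<Longrightarrow> u \<in> L \<Longrightarrow> \<pi> u \<noteq> \<infinity>"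
  by (simp add: rpp_def)

lemma rpp_zero: "rpp L \<pi> \<Longrightarrow> i \<le> 0 \<or> j \<le> 0 \<Longrightarrow> \<pi> (i, j) = 0"
  by (auto simp: rpp_def)

lemma rpp_mono: "rpp L \<pi> \<Longrightarrow> u \<in> L \<Longrightarrow> \<pi> u \<le> \<pi> (east u) \<and> \<pi> u \<le> \<pi> (south u)"
  by (simp add: rpp_def)

locale nonzero_rpp = diagram +
  fixes \<pi> :: filling
  assumes rpp: "rpp L \<pi>" and nonzero: "\<exists>u\<in>L. \<pi> u \<noteq> 0"
begin

lemma mem_or_zero: "u \<in> L \<Longrightarrow> north u \<in> L \<or> \<pi> (north u) = 0" "u \<in> L \<Longrightarrow> west u \<in> L \<or> \<pi> (west u) = 0"
proof -
  obtain i j where u: "u = (i, j)" by (cases u)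
  assume "u \<in> L"
  then have "(i, j) \<in> L" "1 \<le> i" "1 \<le> j" using pos u by auto
  then show "north u \<in> L \<or> \<pi> (north u) = 0" "west u \<in> L \<or> \<pi> (west u) = 0"
    using u rpp_zero[OF rpp, of "i - 1" j] rpp_zero[OF rpp, of i "j - 1"]
      down[of i j "i - 1" j] down[of i j i "j - 1"]
    by (cases "1 < i"; cases "1 < j"; simp)+
qed

lemma mono:
  assumes "u \<in> L"
  shows "\<pi> (north u) \<le> \<pi> u" "\<pi> (west u) \<le> \<pi> u" "\<pi> u \<le> \<pi> (east u)" "\<pi> u \<le> \<pi> (south u)"
    and "\<pi> (west (north u)) \<le> \<pi> (west u)"
proof -
  show "\<pi> (north u) \<le> \<pi> u" using mem_or_zero(1)[OF assms] rpp_mono[OF rpp, of "north u"] by auto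
  show "\<pi> (west u) \<le> \<pi> u" using mem_or_zero(2)[OF assms] rpp_mono[OF rpp, of "west u"] by auto
  show "\<pi> u \<le> \<pi> (east u)" "\<pi> u \<le> \<pi> (south u)" using rpp_mono[OF rpp assms] by auto
  show "\<pi> (west (north u)) \<le> \<pi> (west u)"
  proof (cases "west (north u) \<in> L")
    case True
    then show ?thesis using rpp_mono[OF rpp, of "west (north u)"]
      by (metis cell_moves(1) cell_moves(8))
  next
    case False
    obtain i j where "u = (i, j)" by (cases u)
    then have "\<pi> (west (north u)) = 0"
      using False assms rpp_zero[OF rpp, of "i - 1" "j - 1"] pos[of i j] down[of i j "i - 1" "j - 1"]
      by (cases "1 < i \<and> 1 < j") auto
    then show ?thesis by simp
  qed
qed

section \<open>The removal walk and its invariant\<close>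

definition start_cells :: "cell set" where
  "start_cells = {u \<in> L. \<not> row_end (content u - 1) \<and> \<pi> (west u) < \<pi> u}"

text \<open>A nonzero cell of least content qualifies: its western neighbour has value zero, and a
  southern neighbour in \<open>L\<close> would be nonzero of smaller content.\<close>

lemma start_cells_nonempty: "start_cells \<noteq> {}"
proof -
  let ?N = "{u \<in> L. \<pi> u \<noteq> 0}"
  have N: "finite ?N" "?N \<noteq> {}" using fin nonzero by auto
  define u where "u = arg_min_on content ?N"
  have u: "u \<in> ?N" unfolding u_def by (rule arg_min_if_finite(1)[OF N])
  have min: "content u \<le> content v" if "v \<in> ?N" for v
    unfolding u_def by (rule arg_min_least[OF N that])
  have "\<pi> (west u) = 0" using mem_or_zero(2)[of u] u min[of "west u"] by auto
  moreover have "south u \<notin> L" using min[of "south u"] u mono(4)[of u] by (cases "\<pi> (south u) = 0") auto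
  ultimately have "u \<in> start_cells"
    using u not_row_end_if_south_notin by (auto simp: start_cells_def)
  then show ?thesis by auto
qed

definition start :: cell where
  "start = arg_min_on (\<lambda>u. - content u) start_cells"

lemma start: "start \<in> start_cells" "v \<in> start_cells \<Longrightarrow> content v \<le> content start"
proof -
  have fin': "finite start_cells" using fin by (simp add: start_cells_def)
  show "start \<in> start_cells"
    unfolding start_def by (rule arg_min_if_finite(1)[OF fin' start_cells_nonempty])
  show "content v \<le> content start" if "v \<in> start_cells"
    using arg_min_least[OF fin' start_cells_nonempty that, of "\<lambda>u. - content u"]
    by (simp add: start_def)
qed

definition removal_step :: "cell \<Rightarrow> cell" where
  "removal_step u = (if row_end (content u) \<and> \<pi> (north u) = \<pi> u then north u else east u)"

definition walk :: "nat \<Rightarrow> cell" where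
  "walk k = (removal_step ^^ k) start"

lemma walk_simps: "walk 0 = start" "walk (Suc k) = removal_step (walk k)"
  by (simp_all add: walk_def)

lemma content_walk [simp]: "content (walk k) = content start + int k"
  by (induction k) (auto simp: walk_simps removal_step_def)

lemma walk_eq_iff [simp]: "walk k = walk m \<longleftrightarrow> k = m"
  by (metis add_left_cancel content_walk of_nat_eq_iff)

text \<open>\<open>walk\<close> runs on outside \<open>L\<close>; \<open>stop\<close> is the index
  of its last cell before it first leaves \<open>L\<close>.\<close>

definition stop :: nat where
  "stop = (LEAST k. walk (Suc k) \<notin> L)"

lemma stop: "walk (Suc stop) \<notin> L" "k \<le> stop \<Longrightarrow> walk k \<in> L"
proof -
  have "\<exists>k. walk (Suc k) \<notin> L"
  \<comment> \<open>Contents grow along the walk, so its cells are distinct and cannot all fit into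
    the finite \<open>L\<close>.\<close>
  proof (rule ccontr)
    assume "\<not> ?thesis"
    then have "range (\<lambda>k. walk (Suc k)) \<subseteq> L" by auto
    moreover have "inj (\<lambda>k. walk (Suc k))" by (auto simp: inj_def)
    ultimately show False using fin finite_subset infinite_UNIV_nat finite_imageD by blast
  qed
  then show "walk (Suc stop) \<notin> L" unfolding stop_def by (rule LeastI_ex)
  show "walk k \<in> L" if "k \<le> stop"
  proof (cases k)
    case 0
    then show ?thesis using start by (simp add: walk_simps start_cells_def)
  next
    case (Suc m)
    then show ?thesis using that not_less_Least[of m "\<lambda>k. walk (Suc k) \<notin> L"]
      by (auto simp: stop_def)
  qed
qed

text \<open>A strict increase would make the eastern neighbour a start cell, with content above that
  of \<open>start\<close>.\<close>

lemma east_eq_if_not_row_end: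
  assumes "k \<le> stop" "\<not> row_end (content (walk k))"
  shows "\<pi> (east (walk k)) = \<pi> (walk k)"
proof (rule ccontr)
  let ?u = "walk k"
  assume ne: "\<pi> (east ?u) \<noteq> \<pi> ?u"
  have u: "?u \<in> L" "east ?u \<in> L" using assms stop(2) east_mem_if_not_row_end by auto
  then have "east ?u \<in> start_cells"
    using ne assms mono(3)[of ?u] by (auto simp: start_cells_def)
  then show False using start(2)[of "east ?u"] by simp
qed

text \<open>With equal values, the assumed inequality would make the northern neighbour a start cell
  of too large a content.\<close>

lemma north_less_if_not_row_end:
  assumes "k \<le> stop" "\<not> row_end (content (walk k))" "\<pi> (west (north (walk k))) < \<pi> (walk k)"
  shows "\<pi> (north (walk k)) < \<pi> (walk k)"
proof (rule ccontr)
  let ?u = "walk k"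
  assume "\<not> ?thesis"
  then have eq: "\<pi> (north ?u) = \<pi> ?u" using mono(1) stop(2) assms(1) by (metis order_le_less)
  then have "north ?u \<in> L" using mem_or_zero(1)[of ?u] stop(2) assms by auto
  then have "north ?u \<in> start_cells" using eq assms by (auto simp: start_cells_def)
  then show False using start(2)[of "north ?u"] by simp
qed

lemma walk_invariant: "k \<le> stop \<Longrightarrow> \<pi> (west (north (walk k))) < \<pi> (walk k)"
proof (induction k)
  case 0
  then show ?case using start(1) mono(5)[of start]
    by (auto simp: walk_simps start_cells_def)
next
  case (Suc k)
  let ?u = "walk k"
  have u: "?u \<in> L" "walk (Suc k) \<in> L" using Suc.prems stop(2) by auto
  have inv: "\<pi> (west (north ?u)) < \<pi> ?u" using Suc by simp
  show ?case
  proof (cases "row_end (content ?u) \<and> \<pi> (north ?u) = \<pi> ?u")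
    case True
    then have eq: "walk (Suc k) = north ?u" by (simp add: walk_simps removal_step_def)
    then have "\<pi> (west (north (north ?u))) \<le> \<pi> (west (north ?u))" using mono(5) u by metis
    then show ?thesis using inv True eq by auto
  next
    case False
    then have eq: "walk (Suc k) = east ?u" by (auto simp: walk_simps removal_step_def)
    \<comment> \<open>After an east step, the cell north-west of the new cell is
      \<open>north ?u\<close>.\<close>
    have "\<pi> (north ?u) < \<pi> ?u"
      using False north_less_if_not_row_end[of k] inv Suc.prems mono(1)[OF u(1)] by fastforce
    then show ?thesis using eq mono(3)[OF u(1)] by (simp del: cell_moves(7))
  qed
qed

text \<open>A north step keeps a value that the invariant makes nonzero, so it stays in
  \<open>L\<close>; an east step away from row ends stays in \<open>L\<close> too. Hence the walk
  can leave \<open>L\<close> only eastwards at the end of a row.\<close>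

lemma walk_cases:
  assumes "k \<le> stop"
  obtains (north) "walk (Suc k) = north (walk k)" "k < stop" "row_end (content (walk k))"
      "\<pi> (north (walk k)) = \<pi> (walk k)"
    | (east) "walk (Suc k) = east (walk k)" "\<pi> (north (walk k)) < \<pi> (walk k)"
      "\<not> row_end (content (walk k)) \<Longrightarrow> k < stop \<and> \<pi> (east (walk k)) = \<pi> (walk k)"
proof (cases "row_end (content (walk k)) \<and> \<pi> (north (walk k)) = \<pi> (walk k)")
  case True
  then have eq: "walk (Suc k) = north (walk k)" by (simp add: walk_simps removal_step_def)
  have "north (walk k) \<in> L"
    using mem_or_zero(1)[OF stop(2)[OF assms]] walk_invariant[OF assms] True by auto
  then have "k \<noteq> stop" using eq stop(1) by auto
  then show ?thesis using north True eq assms by simp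
next
  case False
  then have eq: "walk (Suc k) = east (walk k)" by (auto simp: walk_simps removal_step_def)
  have "\<pi> (north (walk k)) < \<pi> (walk k)"
    using False north_less_if_not_row_end[OF assms] walk_invariant[OF assms]
      mono(1)[OF stop(2)[OF assms]] by fastforce
  moreover have "k \<noteq> stop" if "\<not> row_end (content (walk k))"
    using east_mem_if_not_row_end[OF stop(2)[OF assms] that] eq stop(1) by metis
  ultimately show ?thesis using east eq assms east_eq_if_not_row_end[OF assms] by fastforce
qed

text \<open>After a north step this is the invariant at the preceding cell; after an east step the
  western cell is the preceding one.\<close>

lemma west_less_if_west_not_on_walk:
  assumes "k \<le> stop" "\<And>m. m \<le> stop \<Longrightarrow> walk m \<noteq> west (walk k)"
  shows "\<pi> (west (walk k)) < \<pi> (walk k)"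
proof (cases k)
  case 0
  then show ?thesis using start(1) by (simp add: walk_simps start_cells_def)
next
  case (Suc m)
  then have m: "m \<le> stop" using assms by simp
  then show ?thesis
  proof (cases rule: walk_cases)
    case north
    then show ?thesis using Suc walk_invariant[OF m] by simp
  next
    case east
    then show ?thesis using Suc assms(2)[OF m] by simp
  qed
qed

section \<open>Lowering the filling along the walk\<close>

definition hook_removed :: filling where
  "hook_removed u = (if u \<in> walk ` {..stop} then \<pi> u - 1 else \<pi> u)"

lemma pi_walk_nonzero: "k \<le> stop \<Longrightarrow> \<pi> (walk k) \<noteq> 0"
  using walk_invariant by fastforce

lemma walk_mem_iff: "v \<in> walk ` {..stop} \<Longrightarrow> content v = content start + int k \<Longrightarrow> v = walk k"
  by auto

lemma hook_removed_less: "k \<le> stop \<Longrightarrow> hook_removed (walk k) < \<pi> (walk k)"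
  using pi_walk_nonzero[of k] rpp_finite[OF rpp stop(2)[of k]]
  by (cases "\<pi> (walk k)") (auto simp: hook_removed_def one_enat_def zero_enat_def)

lemma hook_removed_le: "hook_removed u \<le> \<pi> u"
  using hook_removed_less by (fastforce simp: hook_removed_def)

text \<open>Order can break only if \<open>v\<close> is lowered and \<open>u\<close> is not, and a
  strict inequality of finite values survives this.\<close>

lemma hook_removed_mono:
  assumes "\<pi> u \<le> \<pi> v" "v \<in> walk ` {..stop} \<Longrightarrow> u \<notin> walk ` {..stop} \<Longrightarrow> \<pi> u < \<pi> v"
  shows "hook_removed u \<le> hook_removed v"
proof (cases "v \<in> walk ` {..stop}")
  case False
  then show ?thesis using assms hook_removed_le[of u] by (auto simp: hook_removed_def)
next
  case True
  then obtain k where "v = walk k" "k \<le> stop" by auto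
  then have "\<pi> v \<noteq> \<infinity>" using rpp_finite[OF rpp stop(2)] by blast
  then show ?thesis using assms True
    by (cases "\<pi> u"; cases "\<pi> v") (auto simp: hook_removed_def one_enat_def)
qed

lemma rpp_hook_removed: "rpp L hook_removed"
proof -
  have out: "hook_removed u = \<pi> u" if "u \<notin> L" for u
    using that stop(2) by (auto simp: hook_removed_def)
  have "hook_removed u \<noteq> \<infinity>" if "u \<in> L" for u
    using hook_removed_le[of u] rpp_finite[OF rpp that] by (cases "hook_removed u") auto
  moreover have "hook_removed u \<le> hook_removed (east u)" if u: "u \<in> L" for u
  proof (rule hook_removed_mono[OF mono(3)[OF u]])
    assume "east u \<in> walk ` {..stop}" and nin: "u \<notin> walk ` {..stop}"
    then obtain k where "east u = walk k" "k \<le> stop" by auto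
    then show "\<pi> u < \<pi> (east u)"
      using west_less_if_west_not_on_walk[of k] nin by (metis atMost_iff cell_moves(4) image_eqI)
  qed
  moreover have "hook_removed u \<le> hook_removed (south u)" if u: "u \<in> L" for u
  proof (rule hook_removed_mono[OF mono(4)[OF u]])
    assume "south u \<in> walk ` {..stop}" and nin: "u \<notin> walk ` {..stop}"
    then obtain k where k: "south u = walk k" "k \<le> stop" by auto
    from k(2) show "\<pi> u < \<pi> (south u)"
    proof (cases rule: walk_cases)
      case north
      then have "u = walk (Suc k)" using k by (metis cell_moves(2))
      then have "u \<in> walk ` {..stop}" using north(2) by auto
      then show ?thesis using nin by blast
    next
      \<comment> \<open>The walk goes east from \<open>south u\<close> only if the value at
        \<open>u\<close> is strictly smaller.\<close>
      case east
      then show ?thesis using k by (metis cell_moves(2))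
    qed
  qed
  moreover have "hook_removed (i, j) = \<pi> (i, j)" if "i \<le> 0 \<or> j \<le> 0" for i j
    using out pos[of i j] that by force
  ultimately show ?thesis using rpp out by (auto simp: rpp_def)
qed

section \<open>The reversed walk as insertion path\<close>

definition removal_path :: "cell list" where
  "removal_path = rev (map walk [0..<Suc stop])"

lemma set_removal_path: "set removal_path = walk ` {..stop}"
  by (auto simp: removal_path_def atLeast0LessThan lessThan_Suc_atMost simp del: upt_Suc)

lemma add_removal_path: "add_path hook_removed removal_path = \<pi>"
proof
  fix u
  show "add_path hook_removed removal_path u = \<pi> u"
  proof (cases "u \<in> walk ` {..stop}")
    case True
    then obtain k where k: "u = walk k" "k \<le> stop" by auto
    then show ?thesis
      using True pi_walk_nonzero[of k] rpp_finite[OF rpp stop(2)[of k]]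
      by (cases "\<pi> u") (auto simp: hook_removed_def add_path_def set_removal_path
          one_enat_def zero_enat_def)
  qed (auto simp: hook_removed_def add_path_def set_removal_path)
qed

lemma compatible_removal_path: "compatible L removal_path hook_removed"
  unfolding compatible_def set_removal_path
proof (intro conjI ballI allI impI)
  fix u assume u: "u \<in> walk ` {..stop} \<inter> (region_I L \<union> region_A L)"
  then obtain k where k: "u = walk k" "k \<le> stop" by auto
  have "u \<in> region_I L \<union> region_A L" using u by blast
  then have nre: "\<not> row_end (content (walk k))" unfolding k(1) by (rule not_row_end_if_region_I_A)
  from k(2) have *: "walk (Suc k) = east u \<and> k < stop \<and> \<pi> (east u) = \<pi> u"
    by (cases rule: walk_cases) (use nre k in auto)
  then show "east u \<in> walk ` {..stop}" by (metis Suc_leI atMost_iff image_eqI)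
  then show "hook_removed u = hook_removed (east u)" using * u by (simp add: hook_removed_def)
next
  fix u assume u: "u \<in> walk ` {..stop} \<and> south u \<in> walk ` {..stop}"
  then obtain k where k: "south u = walk k" "k \<le> stop" by auto
  then have "content u = content start + int (Suc k)"
    using content_walk[of k] content_simps(3)[of u] by simp
  \<comment> \<open>A walk cell is determined by its content, so \<open>u\<close> is the successor
    of \<open>south u\<close>, and that step went north.\<close>
  then have eq: "u = walk (Suc k)" using u walk_mem_iff by blast
  from k(2) have "\<pi> u = \<pi> (south u)"
  proof (cases rule: walk_cases)
    case north
    then show ?thesis using k eq by simp
  next
    case east
    then have "south u = east (south (walk k))" using eq by simp
    then show ?thesis using k eq east by (metis cell_moves(2) cell_moves(9))
  qed
  then show "hook_removed u = hook_removed (south u)" using u by (simp add: hook_removed_def)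
qed

text \<open>A north step starts at a row end, so its target lies in \<B> or \<I>, and equal values
  remain equal as both are lowered. After an east step, the cell south of the target is off the walk
  and keeps its value while the target is lowered, so insertion goes west.\<close>

lemma insertion_step_walk:
  assumes "k < stop"
  shows "insertion_step L hook_removed (walk (Suc k)) = walk k"
proof -
  have k: "k \<le> stop" "Suc k \<le> stop" using assms by auto
  from k(1) show ?thesis
  proof (cases rule: walk_cases)
    case north
    have "walk (Suc k) \<in> region_B L \<union> region_I L"
      using region_B_I_if_row_end[OF stop(2)[OF k(2)]] north by simp
    moreover have "walk k \<in> walk ` {..stop}" "walk (Suc k) \<in> walk ` {..stop}" using k by blast+
    then have "hook_removed (walk (Suc k)) = hook_removed (walk k)"
      using north(1,4) by (simp only: hook_removed_def if_True)
    ultimately show ?thesis using north by (simp add: insertion_step_def)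
  next
    case east
    let ?v = "walk (Suc k)"
    have "south ?v \<notin> walk ` {..stop}"
    proof
      assume "south ?v \<in> walk ` {..stop}"
      then have "south ?v = walk k" by (rule walk_mem_iff) simp
      then show False using east by (metis cell_moves(2) cell_moves(11))
    qed
    then have "hook_removed (south ?v) = \<pi> (south ?v)" by (simp add: hook_removed_def)
    moreover have "hook_removed ?v < \<pi> (south ?v)"
      using hook_removed_less[OF k(2)] mono(4)[OF stop(2)[OF k(2)]] by (rule less_le_trans)
    ultimately have "hook_removed ?v \<noteq> hook_removed (south ?v)" by simp
    then have "insertion_step L hook_removed ?v = west ?v" by (simp only: insertion_step_def) simp
    then show ?thesis using east by simp
  qed
qed

lemma insertion_path_from_walk:
  "k \<le> stop \<Longrightarrow> insertion_path_from L hook_removed (walk k) k = rev (map walk [0..<Suc k])"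
  by (induction k) (auto simp: insertion_step_walk)

lemma sw_path_removal_path: "sw_path L removal_path"
proof -
  have "removal_path ! Suc k \<in> {south (removal_path ! k), west (removal_path ! k)}"
    if "Suc k < length removal_path" for k
  proof -
    define m where "m = stop - Suc k"
    have len: "Suc k \<le> stop" using that by (simp add: removal_path_def)
    then have m: "m \<le> stop" "stop - k = Suc m" by (auto simp: m_def)
    have "removal_path ! Suc k = walk m" "removal_path ! k = walk (Suc m)"
      using len m by (auto simp: removal_path_def rev_nth m_def simp del: upt_Suc)
    moreover from m(1) have "walk m \<in> {south (walk (Suc m)), west (walk (Suc m))}"
      by (cases rule: walk_cases) auto
    ultimately show ?thesis by simp
  qed
  moreover have "set removal_path \<subseteq> L" using stop(2) by (auto simp: set_removal_path)
  ultimately show ?thesis by (simp add: sw_path_def removal_path_def)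
qed

lemma exists_hook:
  "\<exists>h. rim_hook L h \<and> inserts L h hook_removed \<and> insert_hook L h hook_removed = \<pi>"
proof -
  have east_stop: "east (walk stop) \<notin> L"
  proof -
    have "stop \<le> stop" ..
    then show ?thesis by (cases rule: walk_cases) (use stop(1) in auto)
  qed
  have in_L: "walk stop \<in> L" "start \<in> L" using stop(2)[of stop] stop(2)[of 0] by (auto simp: walk_simps)
  obtain h where h: "ne_path L h" "last h = walk stop" "length h = Suc stop"
    "content (hd h) = content start" "\<forall>u\<in>set h. east (south u) \<notin> L"
    using rim_path[of "walk stop" start stop] in_L east_south_notin[OF in_L(1) east_stop] by auto
  have "hd h \<in> set h" "set h \<subseteq> L" using h by (auto simp: ne_path_def)
  \<comment> \<open>Otherwise \<open>south (hd h)\<close> would be a row end of content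
    \<open>content start - 1\<close>, against the choice of \<open>start\<close>.\<close>
  then have "south (hd h) \<notin> L"
    using h start(1) by (auto simp: start_cells_def row_end_def)
  then have "rim_hook L h" using h east_stop by (simp add: rim_hook_def)
  moreover have "hd removal_path = walk stop" "path_length removal_path = path_length h"
    using h by (auto simp: removal_path_def path_length_def)
  then have "inserts L h hook_removed"
    unfolding inserts_def using sw_path_removal_path compatible_removal_path rpp h
    by (intro exI[of _ removal_path]) (simp add: add_removal_path)
  moreover have "insert_hook L h hook_removed = \<pi>"
    using h insertion_path_from_walk[of stop] add_removal_path
    by (simp add: insert_hook_def insertion_path_def path_length_def removal_path_def)
  ultimately show ?thesis by blast
qed

section \<open>Induction on the sum of the entries\<close>

lemma sum_hook_removed_less:
  "(\<Sum>u\<in>L. the_enat (hook_removed u)) < (\<Sum>u\<in>L. the_enat (\<pi> u))"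
proof (rule sum_strict_mono_ex1[OF fin])
  show "\<forall>u\<in>L. the_enat (hook_removed u) \<le> the_enat (\<pi> u)"
  proof
    fix u assume "u \<in> L"
    then show "the_enat (hook_removed u) \<le> the_enat (\<pi> u)"
      using hook_removed_le[of u] rpp_finite[OF rpp, of u]
      by (cases "\<pi> u"; cases "hook_removed u") auto
  qed
  have "hook_removed start < \<pi> start" using hook_removed_less[of 0] by (simp add: walk_simps)
  moreover have "start \<in> L" using start by (simp add: start_cells_def)
  ultimately show "\<exists>u\<in>L. the_enat (hook_removed u) < the_enat (\<pi> u)"
    using rpp_finite[OF rpp, of start]
    by (intro bexI[of _ start]) (cases "\<pi> start"; cases "hook_removed start"; auto)+
qed

end

text \<open>The hook removed first is inserted last, so it is appended to the list obtained for the
  smaller filling.\<close>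

lemma (in diagram) hook_sequence_exists:
  assumes "rpp L \<pi>"
  shows "\<exists>hs. (\<forall>h \<in> set hs. rim_hook L h) \<and>
    (\<forall>i < length hs. inserts L (hs ! i) (insert_hooks L (take i hs))) \<and>
    \<pi> = insert_hooks L hs"
  using assms
proof (induction "\<Sum>u\<in>L. the_enat (\<pi> u)" arbitrary: \<pi> rule: less_induct)
  case less
  show ?case
  proof (cases "\<exists>u\<in>L. \<pi> u \<noteq> 0")
    case False
    \<comment> \<open>Outside \<open>L\<close> the border conventions fix the values, so both
      fillings agree on all cells.\<close>
    then have "\<pi> (i, j) = zero_rpp L (i, j)" for i j
      using less.prems by (cases "1 \<le> i \<and> 1 \<le> j") (auto simp: rpp_def zero_rpp_def)
    then have "\<pi> = zero_rpp L" by auto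
    then show ?thesis by (intro exI[of _ "[]"]) (simp add: insert_hooks_def)
  next
    case True
    then interpret nonzero_rpp L \<pi> using less.prems by unfold_locales auto
    obtain h where h: "rim_hook L h" "inserts L h hook_removed" "insert_hook L h hook_removed = \<pi>"
      using exists_hook by blast
    obtain hs where hs: "\<forall>h \<in> set hs. rim_hook L h"
      "\<forall>i < length hs. inserts L (hs ! i) (insert_hooks L (take i hs))"
      "hook_removed = insert_hooks L hs"
      using less.hyps[OF sum_hook_removed_less rpp_hook_removed] by blast
    have "\<pi> = insert_hooks L (hs @ [h])" using h hs by (simp add: insert_hooks_def)
    moreover have "\<forall>i < length (hs @ [h]).
        inserts L ((hs @ [h]) ! i) (insert_hooks L (take i (hs @ [h])))"
      using h hs by (auto simp: nth_append less_Suc_eq)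
    ultimately show ?thesis using h hs by (intro exI[of _ "hs @ [h]"]) auto
  qed
qed

section \<open>Young diagrams of partitions\<close>

lemma diagram_young_diagram:
  assumes "is_partition p"
  shows "diagram (young_diagram p)"
proof
  let ?L = "young_diagram p"
  \<comment> \<open>For empty \<open>p\<close> the box is empty, whatever the maximum of the empty
    set is.\<close>
  have "?L \<subseteq> {1..int (length p)} \<times> {1..int (Max (set p))}"
  proof
    fix u assume "u \<in> ?L"
    then obtain i j where u: "u = (i, j)" "1 \<le> i" "i \<le> int (length p)" "1 \<le> j"
      "j \<le> int (p ! nat (i - 1))" by (auto simp: young_diagram_def)
    then have "p ! nat (i - 1) \<le> Max (set p)" by (intro Max_ge nth_mem) auto
    then have "j \<le> int (Max (set p))" using u(5) by linarith
    then show "u \<in> {1..int (length p)} \<times> {1..int (Max (set p))}" using u by auto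
  qed
  then show "finite ?L" by (rule finite_subset) auto
  show "1 \<le> i \<and> 1 \<le> j" if "(i, j) \<in> ?L" for i j using that by (simp add: young_diagram_def)
  show "(a, b) \<in> ?L" if "(i, j) \<in> ?L" "1 \<le> a" "a \<le> i" "1 \<le> b" "b \<le> j" for i j a b
  proof -
    have "p ! nat (i - 1) \<le> p ! nat (a - 1)"
    proof (cases "a = i")
      case False
      then show ?thesis
        using that assms sorted_wrt_nth_less[of "(\<ge>)" p "nat (a - 1)" "nat (i - 1)"]
        by (auto simp: is_partition_def young_diagram_def)
    qed simp
    then show ?thesis using that by (auto simp: young_diagram_def)
  qed
qed

theorem mainTheorem9:
  fixes p :: "nat list" and \<pi> :: filling
  assumes "is_partition p"
    and "rpp (young_diagram p) \<pi>"
  shows "\<exists>hs :: cell list list.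
    (\<forall>h \<in> set hs. rim_hook (young_diagram p) h) \<and>
    (\<forall>i < length hs.
       inserts (young_diagram p) (hs ! i) (insert_hooks (young_diagram p) (take i hs))) \<and>
    \<pi> = insert_hooks (young_diagram p) hs"
  using diagram.hook_sequence_exists[OF diagram_young_diagram] assms by blast

end
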